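(* Let $X$ be a closure space and let $\mathcal{U}$ be an interior cover of $X$. The inclusion of chain complexes $\iota:C_\bullet^{\mathcal{U}}(X)\to C_\bullet(X)$ is a chain homotopy equivalence. Hence $\iota$ induces isomorphisms $H_n^{\mathcal{U}}(X)\cong H_n(X)$ for all $n\in\mathbb{Z}$.
   Context: A (Čech) closure space is a pair $(X,c)$ of a set $X$ and a function $c:2^X\to 2^X$ with $c(\varnothing)=\varnothing$, $A\subset c(A)$, and $c(A\cup B)=c(A)\cup c(B)$ for all $A,B\subset X$. Topological spaces are the closure spaces with $c(c(A))=c(A)$ for all $A$, where $c$ is the topological closure. A map $f:(X,c)\to(Y,d)$ is continuous if $f(c(A))\subset d(f(A))$ for all $A\subset X$. The interior operator is $i(A)=X\setminus c(X\setminus A)$. An interior cover of $X$ is a family $\mathcal{U}$ of subsets of $X$ with $X=\bigcup_{U\in\mathcal{U}} i(U)$. Singular homology: let $|\Delta^n|=\{(t_0,\dots,t_n)\in\mathbb{R}^{n+1} : \sum_i t_i=1,\ t_i\ge 0\}=[e_0,\dots,e_n]$ with the Euclidean topology. $C_n(X)$ is the free abelian group on continuous maps $\sigma:|\Delta^n|\to X$ (and $C_n(X)=0$ for $n<0$), $\partial_n(\sigma)=\sum_{i=0}^n(-1)^i\sigma|_{[e_0,\dots,\hat e_i,\dots,e_n]}$, and $H_n(X)=\ker\partial_n/\operatorname{im}\partial_{n+1}$. $C_n^{\mathcal{U}}(X)\subset C_n(X)$ is the subgroup of chains $\sum_i n_i\sigma_i$ such that each $\sigma_i$ has image contained in some element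 of $\mathcal{U}$; these form a subcomplex, whose homology groups are denoted $H_n^{\mathcal{U}}(X)$. *)

theory Defs
  imports "HOL-Homology.Homology"
begin

section \<open>Closure spaces\<close>

text \<open>A closure space has an explicit carrier \<open>X\<close>; the values of \<open>c\<close> on sets that are not
  contained in \<open>X\<close> are irrelevant.\<close>

locale closure_space =
  fixes X :: "'a set" and c :: "'a set \<Rightarrow> 'a set"
  assumes closure_subset_carrier: "A \<subseteq> X \<Longrightarrow> c A \<subseteq> X"
    and closure_empty: "c {} = {}"
    and closure_extensive: "A \<subseteq> X \<Longrightarrow> A \<subseteq> c A"
    and closure_Un: "A \<subseteq> X \<Longrightarrow> B \<subseteq> X \<Longrightarrow> c (A \<union> B) = c A \<union> c B"

definition closure_continuous ::
    "'a set \<Rightarrow> ('a set \<Rightarrow> 'a set) \<Rightarrow> 'b set \<Rightarrow> ('b set \<Rightarrow> 'b set) \<Rightarrow> ('a \<Rightarrow> 'b) \<Rightarrow> bool" where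
  "closure_continuous X c Y d f \<longleftrightarrow> f \<in> X \<rightarrow> Y \<and> (\<forall>A\<subseteq>X. f ` c A \<subseteq> d (f ` A))"

definition closure_interior :: "'a set \<Rightarrow> ('a set \<Rightarrow> 'a set) \<Rightarrow> 'a set \<Rightarrow> 'a set" where
  "closure_interior X c A = X - c (X - A)"

definition interior_cover :: "'a set \<Rightarrow> ('a set \<Rightarrow> 'a set) \<Rightarrow> 'a set set \<Rightarrow> bool" where
  "interior_cover X c \<U> \<longleftrightarrow> \<U> \<subseteq> Pow X \<and> X = (\<Union>U\<in>\<U>. closure_interior X c U)"

lemma closure_space_topology: "closure_space (topspace T) ((closure_of) T)"
  by unfold_locales (auto simp: closure_of_subset_topspace closure_of_subset closure_of_Un)

lemma closure_continuous_topology: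
  "closure_continuous (topspace S) ((closure_of) S) (topspace T) ((closure_of) T) f
     \<longleftrightarrow> continuous_map S T f"
proof
  assume "continuous_map S T f"
  then show "closure_continuous (topspace S) ((closure_of) S) (topspace T) ((closure_of) T) f"
    unfolding closure_continuous_def
    by (simp add: continuous_map_funspace continuous_map_image_closure_subset)
next
  assume "closure_continuous (topspace S) ((closure_of) S) (topspace T) ((closure_of) T) f"
  then show "continuous_map S T f"
    unfolding closure_continuous_def continuous_map_eq_image_closure_subset_alt
    by blast
qed

section \<open>Chain complexes of abelian groups\<close>

text \<open>A complex is indexed by the integers, with \<open>bdry C n\<close> going from degree \<open>n\<close> to degree
  \<open>n - 1\<close>. The groups follow the multiplicative conventions of \<open>HOL-Algebra\<close>.\<close>

record 'a complex_data =
  grp :: "int \<Rightarrow> 'a monoid"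
  bdry :: "int \<Rightarrow> 'a \<Rightarrow> 'a"

definition chain_complex :: "'a complex_data \<Rightarrow> bool" where
  "chain_complex C \<longleftrightarrow>
     (\<forall>n. comm_group (grp C n)) \<and>
     (\<forall>n. bdry C n \<in> hom (grp C n) (grp C (n - 1))) \<and>
     (\<forall>n. \<forall>x\<in>carrier (grp C n). bdry C (n - 1) (bdry C n x) = \<one>\<^bsub>grp C (n - 2)\<^esub>)"

definition complex_map :: "'a complex_data \<Rightarrow> 'b complex_data \<Rightarrow> (int \<Rightarrow> 'a \<Rightarrow> 'b) \<Rightarrow> bool" where
  "complex_map C D f \<longleftrightarrow>
     (\<forall>n. f n \<in> hom (grp C n) (grp D n)) \<and>
     (\<forall>n. \<forall>x\<in>carrier (grp C n). bdry D n (f n x) = f (n - 1) (bdry C n x))"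

definition chain_homotopic ::
    "'a complex_data \<Rightarrow> 'b complex_data \<Rightarrow> (int \<Rightarrow> 'a \<Rightarrow> 'b) \<Rightarrow> (int \<Rightarrow> 'a \<Rightarrow> 'b) \<Rightarrow> bool" where
  "chain_homotopic C D f g \<longleftrightarrow>
     (\<exists>h. (\<forall>n. h n \<in> hom (grp C n) (grp D (n + 1))) \<and>
          (\<forall>n. \<forall>x\<in>carrier (grp C n).
             f n x \<otimes>\<^bsub>grp D n\<^esub> inv\<^bsub>grp D n\<^esub> (g n x)
               = bdry D (n + 1) (h n x) \<otimes>\<^bsub>grp D n\<^esub> h (n - 1) (bdry C n x)))"

definition chain_homotopy_equivalence ::
    "'a complex_data \<Rightarrow> 'b complex_data \<Rightarrow> (int \<Rightarrow> 'a \<Rightarrow> 'b) \<Rightarrow> bool" where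
  "chain_homotopy_equivalence C D f \<longleftrightarrow>
     chain_complex C \<and> chain_complex D \<and> complex_map C D f \<and>
     (\<exists>g. complex_map D C g \<and>
          chain_homotopic C C (\<lambda>n. g n \<circ> f n) (\<lambda>n x. x) \<and>
          chain_homotopic D D (\<lambda>n. f n \<circ> g n) (\<lambda>n x. x))"

definition cycle_group :: "'a complex_data \<Rightarrow> int \<Rightarrow> 'a monoid" where
  "cycle_group C n = (grp C n)\<lparr>carrier := kernel (grp C n) (grp C (n - 1)) (bdry C n)\<rparr>"

definition boundaries :: "'a complex_data \<Rightarrow> int \<Rightarrow> 'a set" where
  "boundaries C n = bdry C (n + 1) ` carrier (grp C (n + 1))"

definition complex_homology :: "'a complex_data \<Rightarrow> int \<Rightarrow> 'a set monoid" where
  "complex_homology C n = cycle_group C n Mod boundaries C n"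

text \<open>The class \<open>R\<close> of a cycle \<open>z\<close> is sent to the class of \<open>f n z\<close>: for a chain map \<open>f\<close> the
  classes of \<open>f n x\<close>, with \<open>x\<close> ranging over \<open>R\<close>, coincide, so their union is that class.\<close>

definition homology_map ::
    "'a complex_data \<Rightarrow> 'b complex_data \<Rightarrow> (int \<Rightarrow> 'a \<Rightarrow> 'b) \<Rightarrow> int \<Rightarrow> 'a set \<Rightarrow> 'b set" where
  "homology_map C D f n R = (\<Union>x\<in>R. boundaries D n #>\<^bsub>cycle_group D n\<^esub> f n x)"

section \<open>Singular chains of a closure space\<close>

text \<open>The library's \<open>standard_simplex n\<close> lies in the sequences that vanish beyond index \<open>n\<close>, and
  its topology is the one induced from Euclidean \<open>n + 1\<close>-space.\<close>

abbreviation simplex_topology :: "nat \<Rightarrow> (nat \<Rightarrow> real) topology" where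
  "simplex_topology n \<equiv> subtopology (powertop_real UNIV) (standard_simplex n)"

lemma simplex_topology_Euclidean:
  "simplex_topology n = subtopology (Euclidean_space (Suc n)) (standard_simplex n)"
proof -
  have "{x. \<forall>i\<ge>Suc n. x i = 0} \<inter> standard_simplex n = standard_simplex n"
    by (auto simp: standard_simplex_def)
  then show ?thesis
    by (simp add: Euclidean_space_def subtopology_subtopology)
qed

text \<open>As in the library, a simplex is a total function made canonical outside the standard
  simplex by extensionality.\<close>

definition closure_simplex ::
    "'a set \<Rightarrow> ('a set \<Rightarrow> 'a set) \<Rightarrow> nat \<Rightarrow> ((nat \<Rightarrow> real) \<Rightarrow> 'a) \<Rightarrow> bool" where
  "closure_simplex X c n \<sigma> \<longleftrightarrow>
     closure_continuous (standard_simplex n) ((closure_of) (simplex_topology n)) X c \<sigma> \<and>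
     \<sigma> \<in> extensional (standard_simplex n)"

lemma closure_simplex_topology:
  "closure_simplex (topspace T) ((closure_of) T) n \<sigma> \<longleftrightarrow> singular_simplex n T \<sigma>"
  using closure_continuous_topology[of "simplex_topology n" T \<sigma>]
  by (simp add: closure_simplex_def singular_simplex_def)

text \<open>In negative degrees there are no simplices, so the chain group is trivial.\<close>

definition closure_chain_group :: "'a set \<Rightarrow> ('a set \<Rightarrow> 'a set) \<Rightarrow> int \<Rightarrow> 'a chain monoid" where
  "closure_chain_group X c n = free_Abelian_group {\<sigma>. 0 \<le> n \<and> closure_simplex X c (nat n) \<sigma>}"

definition small_chain_group ::
    "'a set \<Rightarrow> ('a set \<Rightarrow> 'a set) \<Rightarrow> 'a set set \<Rightarrow> int \<Rightarrow> 'a chain monoid" where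
  "small_chain_group X c \<U> n = (closure_chain_group X c n)
     \<lparr>carrier := {z \<in> carrier (closure_chain_group X c n).
        \<forall>\<sigma>\<in>Poly_Mapping.keys z. \<exists>U\<in>\<U>. \<sigma> ` standard_simplex (nat n) \<subseteq> U}\<rparr>"

text \<open>The library's \<open>chain_boundary n\<close> is the alternating sum of the faces for \<open>n > 0\<close>, and
  zero for \<open>n = 0\<close>.\<close>

definition singular_complex :: "'a set \<Rightarrow> ('a set \<Rightarrow> 'a set) \<Rightarrow> 'a chain complex_data" where
  "singular_complex X c =
     \<lparr>grp = closure_chain_group X c, bdry = (\<lambda>n. chain_boundary (nat n))\<rparr>"

definition small_complex ::
    "'a set \<Rightarrow> ('a set \<Rightarrow> 'a set) \<Rightarrow> 'a set set \<Rightarrow> 'a chain complex_data" where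
  "small_complex X c \<U> =
     \<lparr>grp = small_chain_group X c \<U>, bdry = (\<lambda>n. chain_boundary (nat n))\<rparr>"

lemma complex_homology_topology:
  "complex_homology (singular_complex (topspace T) ((closure_of) T)) (int n)
     = homology_group (int n) T"
proof -
  let ?C = "singular_complex (topspace T) ((closure_of) T)"
  note unfold = singular_complex_def closure_chain_group_def closure_simplex_topology
    free_Abelian_group_def singular_chain_def
  have "kernel (grp ?C (int n)) (grp ?C (int n - 1)) (bdry ?C (int n)) = singular_relcycle_set n T {}"
    by (auto simp: kernel_def singular_cycle unfold)
  then have "cycle_group ?C (int n) = relcycle_group n T {}"
    unfolding cycle_group_def by (intro monoid.equality) (auto simp: unfold)
  moreover have "boundaries ?C (int n) = singular_relboundary_set n T {}"
    by (simp add: nat_add_distrib boundaries_def singular_boundary unfold set_eq_iff image_iff) blast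
  ultimately show ?thesis
    by (simp add: complex_homology_def relative_homology_group_def)
qed

end

theory Submission
  imports Defs
begin

text \<open>
  Barycentric subdivision \<open>S\<close> is chain homotopic to the identity, and a fixed simplex \<open>\<sigma>\<close> becomes
  small after finitely many subdivisions. The number of subdivisions depends on \<open>\<sigma>\<close>, so in general no power
  of \<open>S\<close> maps all chains to small ones. Following the classical argument for topological spaces,
  let \<open>D\<^sub>n = (\<Sum>i<n. K S\<^sup>i)\<close>, where \<open>\<partial>K + K\<partial> = S - 1\<close>, so that \<open>\<partial>D\<^sub>n + D\<^sub>n\<partial> = S\<^sup>n - 1\<close>. With a
  number \<open>m(\<sigma>)\<close> chosen for every simplex, put \<open>D(\<sigma>) = D\<^bsub>m(\<sigma>)\<^esub>(\<sigma>)\<close> and \<open>\<rho> = 1 + \<partial>D + D\<partial>\<close>. This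
  \<open>\<rho>\<close> is a chain map homotopic to the identity for any choice of \<open>m\<close>, and
  \<open>\<rho>(\<sigma>) = S\<^bsup>m(\<sigma>)\<^esup>(\<sigma>) + (D - D\<^bsub>m(\<sigma>)\<^esub>)(\<partial>\<sigma>)\<close>. On a face \<open>\<tau>\<close> of \<open>\<sigma>\<close> the difference \<open>D - D\<^bsub>m(\<sigma>)\<^esub>\<close>
  is, up to sign, the sum of \<open>K S\<^sup>i \<tau>\<close> over \<open>i\<close> between \<open>m(\<tau>)\<close> and \<open>m(\<sigma>)\<close>. If \<open>m(\<sigma>)\<close> is so large
  that from this power on the subdivisions of \<open>\<sigma>\<close> and of all its faces are small, each of these
  terms is small, and \<open>\<rho>\<close> takes values in small chains. Since \<open>D\<close> also maps small chains to small
  chains, \<open>\<rho>\<close> is a homotopy inverse of the inclusion (lemma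
  \<open>chain_homotopy_equivalence_small_complex\<close>). The statement about homology is then formal (lemma
  \<open>chain_homotopy_equivalence_imp_homology_iso\<close>).

  Closure spaces enter in two places. First, \<open>S\<close>, \<open>K\<close> and the faces are obtained by composing
  \<open>\<sigma>\<close> with continuous maps between standard simplices, so they stay within the simplices of a
  closure space and do not enlarge the image of \<open>\<sigma>\<close>. Secondly, if \<open>\<sigma>\<close> is continuous, the
  preimage of the interior of \<open>U\<close> lies in the topological interior of the preimage of \<open>U\<close>; an
  interior cover thus pulls back to an open cover of the standard simplex, and the
  Lebesgue number argument applies there (lemma \<open>eventually_small_subdivision\<close>).
\<close>

section \<open>Homology of chain homotopy equivalences\<close>

abbreviation homology_class :: "'a complex_data \<Rightarrow> int \<Rightarrow> 'a \<Rightarrow> 'a set" where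
  "homology_class C n z \<equiv> boundaries C n #>\<^bsub>cycle_group C n\<^esub> z"

lemma carrier_cycle_group:
  "z \<in> carrier (cycle_group C n)
     \<longleftrightarrow> z \<in> carrier (grp C n) \<and> bdry C n z = \<one>\<^bsub>grp C (n - 1)\<^esub>"
  by (simp add: cycle_group_def kernel_def)

lemma mult_cycle_group [simp]: "x \<otimes>\<^bsub>cycle_group C n\<^esub> y = x \<otimes>\<^bsub>grp C n\<^esub> y"
  by (simp add: cycle_group_def)

lemma chain_complex_group_hom:
  assumes "chain_complex C"
  shows "group_hom (grp C n) (grp C (n - 1)) (bdry C n)"
  using assms by (auto simp: chain_complex_def group_hom_def group_hom_axioms_def comm_group_def)

lemma comm_group_cycle_group:
  assumes "chain_complex C"
  shows "comm_group (cycle_group C n)"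
proof (rule group.group_comm_groupI)
  interpret group_hom "grp C n" "grp C (n - 1)" "bdry C n"
    by (rule chain_complex_group_hom[OF assms])
  show "group (cycle_group C n)"
    unfolding cycle_group_def by (rule subgroup.subgroup_is_group[OF subgroup_kernel G.is_group])
  interpret comm_group "grp C n"
    using assms by (simp add: chain_complex_def)
  show "x \<otimes>\<^bsub>cycle_group C n\<^esub> y = y \<otimes>\<^bsub>cycle_group C n\<^esub> x"
    if "x \<in> carrier (cycle_group C n)" "y \<in> carrier (cycle_group C n)" for x y
    using that by (simp add: carrier_cycle_group m_comm)
qed

lemma boundaries_normal:
  assumes C: "chain_complex C"
  shows "boundaries C n \<lhd> cycle_group C n"
proof -
  interpret Z: comm_group "cycle_group C n"
    by (rule comm_group_cycle_group[OF C])
  have "bdry C (n + 1) \<in> hom (grp C (n + 1)) (cycle_group C n)"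
  proof -
    have "bdry C (n + 1) \<in> hom (grp C (n + 1)) (grp C (n + 1 - 1))"
        "\<forall>x\<in>carrier (grp C (n + 1)). bdry C (n + 1 - 1) (bdry C (n + 1) x) = \<one>\<^bsub>grp C (n + 1 - 2)\<^esub>"
      using C unfolding chain_complex_def by blast+
    then show ?thesis
      by (auto simp: hom_def carrier_cycle_group)
  qed
  moreover have "group (grp C (n + 1))"
    using C by (simp add: chain_complex_def comm_group_def)
  ultimately interpret group_hom "grp C (n + 1)" "cycle_group C n" "bdry C (n + 1)"
    by (intro group_hom.intro group_hom_axioms.intro Z.is_group)
  show ?thesis
    unfolding boundaries_def by (rule Z.subgroup_imp_normal[OF img_is_subgroup])
qed

lemma carrier_complex_homology:
  "carrier (complex_homology C n) = homology_class C n ` carrier (cycle_group C n)"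
  by (simp add: complex_homology_def carrier_FactGroup)

lemma mult_homology_class:
  assumes "chain_complex C" "x \<in> carrier (cycle_group C n)" "y \<in> carrier (cycle_group C n)"
  shows "homology_class C n x \<otimes>\<^bsub>complex_homology C n\<^esub> homology_class C n y
       = homology_class C n (x \<otimes>\<^bsub>grp C n\<^esub> y)"
  using normal.rcos_sum[OF boundaries_normal assms(2,3)] assms(1)
  by (simp add: complex_homology_def)

lemma homology_class_eqI:
  assumes C: "chain_complex C" and "b \<in> boundaries C n" and z: "z \<in> carrier (cycle_group C n)"
  shows "homology_class C n (b \<otimes>\<^bsub>grp C n\<^esub> z) = homology_class C n z"
proof -
  interpret normal "boundaries C n" "cycle_group C n"
    by (rule boundaries_normal[OF C])
  have "b \<otimes>\<^bsub>grp C n\<^esub> z \<in> homology_class C n z"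
    using rcosI[OF assms(2) subset z] by simp
  then show ?thesis
    using repr_independence[OF _ z is_subgroup] by simp
qed

lemma complex_map_cycle:
  assumes "chain_complex C" "chain_complex D" and f: "complex_map C D f"
    and z: "z \<in> carrier (cycle_group C n)"
  shows "f n z \<in> carrier (cycle_group D n)"
proof -
  have f_hom: "\<And>n. f n \<in> hom (grp C n) (grp D n)"
    using f by (simp add: complex_map_def)
  have "f (n - 1) \<one>\<^bsub>grp C (n - 1)\<^esub> = \<one>\<^bsub>grp D (n - 1)\<^esub>"
    using assms(1,2) by (intro hom_one[OF f_hom]) (auto simp: chain_complex_def comm_group_def)
  then show ?thesis
    using f z hom_in_carrier[OF f_hom] by (auto simp: complex_map_def carrier_cycle_group)
qed

text \<open>A chain map sends boundaries to boundaries, so all members of a class have images in one class,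
  and the union that defines the induced map collapses to it.\<close>

lemma homology_map_class:
  assumes C: "chain_complex C" and D: "chain_complex D" and f: "complex_map C D f"
    and z: "z \<in> carrier (cycle_group C n)"
  shows "homology_map C D f n (homology_class C n z) = homology_class D n (f n z)"
proof -
  interpret normal "boundaries C n" "cycle_group C n"
    by (rule boundaries_normal[OF C])
  have "homology_class D n (f n x) = homology_class D n (f n z)" if x: "x \<in> homology_class C n z" for x
  proof -
    obtain b where b: "b \<in> boundaries C n" "x = b \<otimes>\<^bsub>grp C n\<^esub> z"
      using x by (auto simp: r_coset_def)
    then obtain y where y: "y \<in> carrier (grp C (n + 1))" "b = bdry C (n + 1) y"
      by (auto simp: boundaries_def)
    have hom: "\<And>n. f n \<in> hom (grp C n) (grp D n)"
      using f by (simp add: complex_map_def)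
    have "bdry D (n + 1) (f (n + 1) y) = f (n + 1 - 1) (bdry C (n + 1) y)"
      using f y unfolding complex_map_def by blast
    then have "f n b = bdry D (n + 1) (f (n + 1) y)"
      using y by simp
    then have "f n b \<in> boundaries D n"
      using hom_in_carrier[OF hom y(1)] by (simp add: boundaries_def)
    moreover have "f n x = f n b \<otimes>\<^bsub>grp D n\<^esub> f n z"
      using b z subset by (auto simp: carrier_cycle_group subset_iff intro!: hom_mult[OF hom])
    ultimately show ?thesis
      using homology_class_eqI[OF D _ complex_map_cycle[OF C D f z]] by simp
  qed
  moreover have "z \<in> homology_class C n z"
    by (rule rcos_self[OF z is_subgroup])
  ultimately show ?thesis
    unfolding homology_map_def by blast
qed

lemma homology_map_hom:
  assumes C: "chain_complex C" and D: "chain_complex D" and f: "complex_map C D f"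
  shows "homology_map C D f n \<in> hom (complex_homology C n) (complex_homology D n)"
proof (rule homI)
  fix R assume "R \<in> carrier (complex_homology C n)"
  then show "homology_map C D f n R \<in> carrier (complex_homology D n)"
    using complex_map_cycle[OF assms] homology_map_class[OF assms]
    by (auto simp: carrier_complex_homology)
next
  fix R R' assume "R \<in> carrier (complex_homology C n)" "R' \<in> carrier (complex_homology C n)"
  then obtain x y where x: "x \<in> carrier (cycle_group C n)" "R = homology_class C n x"
    and y: "y \<in> carrier (cycle_group C n)" "R' = homology_class C n y"
    by (auto simp: carrier_complex_homology)
  have "x \<otimes>\<^bsub>grp C n\<^esub> y \<in> carrier (cycle_group C n)"
    using monoid.m_closed[of "cycle_group C n" x y] comm_group_cycle_group[OF C, of n] x y
    by (simp add: comm_group_def group_def)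
  moreover have "f n (x \<otimes>\<^bsub>grp C n\<^esub> y) = f n x \<otimes>\<^bsub>grp D n\<^esub> f n y"
    using f x y by (auto simp: complex_map_def carrier_cycle_group intro: hom_mult)
  ultimately show "homology_map C D f n (R \<otimes>\<^bsub>complex_homology C n\<^esub> R')
      = homology_map C D f n R \<otimes>\<^bsub>complex_homology D n\<^esub> homology_map C D f n R'"
    using x y by (simp add: mult_homology_class[OF C] mult_homology_class[OF D]
        homology_map_class[OF assms] complex_map_cycle[OF assms])
qed

text \<open>On a cycle \<open>z\<close> the term \<open>h(\<partial>z)\<close> of the homotopy vanishes, hence \<open>f z\<close> and \<open>g z\<close> differ by the
  boundary of \<open>h z\<close>.\<close>

lemma chain_homotopic_homology_class:
  assumes C: "chain_complex C" and D: "chain_complex D"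
    and "chain_homotopic C D f g"
    and z: "z \<in> carrier (cycle_group C n)"
    and fz: "f n z \<in> carrier (cycle_group D n)" and gz: "g n z \<in> carrier (cycle_group D n)"
  shows "homology_class D n (f n z) = homology_class D n (g n z)"
proof -
  obtain h where h: "\<And>n. h n \<in> hom (grp C n) (grp D (n + 1))"
    and fg: "\<And>n x. x \<in> carrier (grp C n) \<Longrightarrow> f n x \<otimes>\<^bsub>grp D n\<^esub> inv\<^bsub>grp D n\<^esub> (g n x)
               = bdry D (n + 1) (h n x) \<otimes>\<^bsub>grp D n\<^esub> h (n - 1) (bdry C n x)"
    using assms(3) by (auto simp: chain_homotopic_def)
  interpret D: comm_group "grp D n"
    using D by (simp add: chain_complex_def)
  have carr: "z \<in> carrier (grp C n)" "f n z \<in> carrier (grp D n)" "g n z \<in> carrier (grp D n)"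
    using z fz gz by (auto simp: carrier_cycle_group)
  have "h (n - 1) \<one>\<^bsub>grp C (n - 1)\<^esub> = \<one>\<^bsub>grp D (n - 1 + 1)\<^esub>"
    using C D by (intro hom_one[OF h]) (auto simp: chain_complex_def comm_group_def)
  then have h1: "h (n - 1) (bdry C n z) = \<one>\<^bsub>grp D n\<^esub>"
    using z by (simp add: carrier_cycle_group)
  have hz: "bdry D (n + 1) (h n z) \<in> boundaries D n"
    using hom_in_carrier[OF h carr(1)] by (simp add: boundaries_def)
  then have "bdry D (n + 1) (h n z) \<in> carrier (grp D n)"
    using normal_imp_subgroup[OF boundaries_normal[OF D, of n]]
    by (meson carrier_cycle_group subgroup.mem_carrier)
  then have "f n z \<otimes>\<^bsub>grp D n\<^esub> inv\<^bsub>grp D n\<^esub> (g n z) = bdry D (n + 1) (h n z)"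
    using fg[OF carr(1)] h1 by simp
  then have "f n z = bdry D (n + 1) (h n z) \<otimes>\<^bsub>grp D n\<^esub> g n z"
    using carr by (metis D.inv_closed D.l_inv D.m_assoc D.r_one)
  then show ?thesis
    using homology_class_eqI[OF D hz gz] by simp
qed

lemma chain_homotopy_equivalence_imp_homology_iso:
  assumes "chain_homotopy_equivalence C D f"
  shows "homology_map C D f n \<in> iso (complex_homology C n) (complex_homology D n)"
proof -
  have C: "chain_complex C" and D: "chain_complex D" and f: "complex_map C D f"
    using assms by (auto simp: chain_homotopy_equivalence_def)
  obtain g where g: "complex_map D C g"
    and gf: "chain_homotopic C C (\<lambda>n. g n \<circ> f n) (\<lambda>n x. x)"
    and fg: "chain_homotopic D D (\<lambda>n. f n \<circ> g n) (\<lambda>n x. x)"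
    using assms by (auto simp: chain_homotopy_equivalence_def)
  note fz = complex_map_cycle[OF C D f] and gz = complex_map_cycle[OF D C g]
  have "homology_map D C g n (homology_map C D f n R) = R"
    if "R \<in> carrier (complex_homology C n)" for R
    using that chain_homotopic_homology_class[OF C C gf] fz gz
    by (auto simp: carrier_complex_homology homology_map_class[OF C D f] homology_map_class[OF D C g])
  moreover have "homology_map C D f n (homology_map D C g n R) = R"
    if "R \<in> carrier (complex_homology D n)" for R
    using that chain_homotopic_homology_class[OF D D fg] fz gz
    by (auto simp: carrier_complex_homology homology_map_class[OF C D f] homology_map_class[OF D C g])
  moreover have "homology_map C D f n \<in> carrier (complex_homology C n) \<rightarrow> carrier (complex_homology D n)"
    "homology_map D C g n \<in> carrier (complex_homology D n) \<rightarrow> carrier (complex_homology C n)"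
    using homology_map_hom[OF C D f, of n] homology_map_hom[OF D C g, of n] by (auto simp: hom_def)
  ultimately have "bij_betw (homology_map C D f n)
      (carrier (complex_homology C n)) (carrier (complex_homology D n))"
    by (intro bij_betw_byWitness[where f' = "homology_map D C g n"]) auto
  then show ?thesis
    using homology_map_hom[OF C D f] by (simp add: iso_def)
qed

section \<open>Operators on chains induced by chains in the standard simplex\<close>

abbreviation standard_chain :: "nat \<Rightarrow> (nat \<Rightarrow> real) chain" where
  "standard_chain p \<equiv> frag_of (restrict id (standard_simplex p))"

text \<open>Identities between singular chains that follow from formal properties of simplices hold for
  all functions on standard simplices, continuous or not. They are transferred from topological
  spaces by means of the indiscrete topology, for which every function is continuous.\<close>

abbreviation indiscrete :: "'a topology" where
  "indiscrete \<equiv> pullback_topology UNIV (\<lambda>_. ()) (discrete_topology UNIV)"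

lemma continuous_map_indiscrete: "continuous_map T indiscrete f"
  by (rule continuous_map_pullback') (auto simp: o_def)

lemma singular_simplex_indiscrete:
  "singular_simplex p indiscrete \<sigma> \<longleftrightarrow> \<sigma> \<in> extensional (standard_simplex p)"
  by (simp add: singular_simplex_def continuous_map_indiscrete)

lemma singular_chain_indiscrete:
  "singular_chain p indiscrete z \<longleftrightarrow> Poly_Mapping.keys z \<subseteq> extensional (standard_simplex p)"
  by (auto simp: singular_chain_def singular_simplex_indiscrete)

lemma keys_frag_extend_subset:
  assumes "\<And>x. x \<in> Poly_Mapping.keys z \<Longrightarrow> Poly_Mapping.keys (f x) \<subseteq> S"
  shows "Poly_Mapping.keys (frag_extend f z) \<subseteq> S"
  using keys_frag_extend[of f z] assms by blast

lemma keys_sum_subset: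
  assumes "\<And>i. i \<in> I \<Longrightarrow> Poly_Mapping.keys (f i) \<subseteq> S"
  shows "Poly_Mapping.keys (sum f I) \<subseteq> S"
  using keys_sum[of f I] assms by blast

lemma keys_add_subset:
  "Poly_Mapping.keys a \<subseteq> S \<Longrightarrow> Poly_Mapping.keys b \<subseteq> S \<Longrightarrow> Poly_Mapping.keys (a + b) \<subseteq> S"
  using keys_add[of a b] by blast

lemma keys_diff_subset:
  "Poly_Mapping.keys a \<subseteq> S \<Longrightarrow> Poly_Mapping.keys b \<subseteq> S \<Longrightarrow> Poly_Mapping.keys (a - b) \<subseteq> S"
  using keys_diff[of a b] by blast

text \<open>Natural operations on singular chains are determined by their value \<open>u\<close> on the identity of
  the standard simplex: the value on \<open>\<sigma>\<close> is the image of \<open>u\<close> under \<open>\<sigma>\<close>. Subdivision and its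
  homotopy to the identity are of this kind.\<close>

definition model_operator :: "nat \<Rightarrow> (nat \<Rightarrow> real) chain \<Rightarrow> 'a chain \<Rightarrow> 'a chain" where
  "model_operator q u = frag_extend (\<lambda>\<sigma>. chain_map q \<sigma> u)"

lemma model_operator_of: "model_operator q u (frag_of \<sigma>) = chain_map q \<sigma> u"
  by (simp add: model_operator_def)

lemma model_operator_diff: "model_operator q u (a - b) = model_operator q u a - model_operator q u b"
  by (simp add: model_operator_def frag_extend_diff)

lemma model_operator_chain_map:
  assumes "singular_chain q (simplex_topology p) u"
  shows "model_operator q u (chain_map p g z) = chain_map q g (model_operator q u z)"
proof -
  have "chain_map q (simplex_map p g f) u = chain_map q g (chain_map q f u)" for f
  proof -
    have "chain_map q (simplex_map p g f) u = chain_map q (g \<circ> f) u"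
      using assms by (rule chain_map_eq) (auto simp: simplex_map_def)
    then show ?thesis
      by (simp add: chain_map_compose)
  qed
  note compose = this
  show ?thesis
    using subset_UNIV[of "Poly_Mapping.keys z"]
    by (induction z rule: frag_induction)
       (auto simp: compose model_operator_def frag_extend_diff chain_map_diff)
qed

lemma singular_subdivision_model:
  "singular_subdivision p = model_operator p (simplicial_subdivision p (standard_chain p))"
  by (simp add: singular_subdivision_def model_operator_def)

lemma simplicial_chain_standard: "simplicial_chain p (standard_simplex p) (standard_chain p)"
  by simp

lemma singular_chain_subdivided_standard:
  "singular_chain p (simplex_topology p) (simplicial_subdivision p (standard_chain p))"
  by (intro simplicial_imp_singular_chain simplicial_chain_simplicial_subdivision
      simplicial_chain_standard)

definition subdivision_homotopy :: "nat \<Rightarrow> 'a chain \<Rightarrow> 'a chain" where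
  "subdivision_homotopy p = model_operator (Suc p) (subd p (standard_chain p))"

lemma singular_chain_subd_standard:
  "singular_chain (Suc p) (simplex_topology p) (subd p (standard_chain p))"
  by (intro simplicial_imp_singular_chain chain_homotopic_simplicial_subdivision2
      simplicial_chain_standard)

lemma subdivision_homotopy_diff:
  "subdivision_homotopy p (a - b) = subdivision_homotopy p a - subdivision_homotopy p b"
  by (simp add: subdivision_homotopy_def model_operator_diff)

lemma subdivision_homotopy_0 [simp]: "subdivision_homotopy p 0 = 0"
  by (simp add: subdivision_homotopy_def model_operator_def)

lemma subdivision_homotopy_chain_map:
  "subdivision_homotopy p (chain_map p g z) = chain_map (Suc p) g (subdivision_homotopy p z)"
  unfolding subdivision_homotopy_def
  by (rule model_operator_chain_map[OF singular_chain_subd_standard])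

lemma subdivision_homotopy_simplicial:
  assumes "simplicial_chain p (standard_simplex q) z"
  shows "subdivision_homotopy p z = subd p z"
  using assms unfolding simplicial_chain_def
proof (induction z rule: frag_induction)
  case (one g)
  then have g: "simplicial_simplex p (standard_simplex q) g"
    by simp
  have "chain_map p g (standard_chain p) = frag_of g"
    using g singular_simplex_chain_map_id simplicial_imp_singular_simplex by blast
  then show ?case
    using chain_homotopic_simplicial_subdivision1[OF simplicial_chain_standard g]
    by (simp add: subdivision_homotopy_def model_operator_of)
qed (auto simp: subdivision_homotopy_diff)

text \<open>Both sides are natural, so it suffices to have the identity for the identity of the standard
  simplex, where it is the one for linear simplices; composition with \<open>\<sigma>\<close> gives the rest.\<close>

lemma boundary_subdivision_homotopy:
  assumes "singular_chain p T z"
  shows "chain_boundary (Suc p) (subdivision_homotopy p z)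
       + subdivision_homotopy (p - Suc 0) (chain_boundary p z) = singular_subdivision p z - z"
  using assms unfolding singular_chain_def
proof (induction z rule: frag_induction)
  case (one \<sigma>)
  let ?\<iota> = "standard_chain p"
  have \<sigma>: "chain_map p \<sigma> ?\<iota> = frag_of \<sigma>"
    using one singular_simplex_chain_map_id by blast
  have K\<sigma>: "subdivision_homotopy p (frag_of \<sigma>) = chain_map (Suc p) \<sigma> (subd p ?\<iota>)"
    by (simp add: subdivision_homotopy_def model_operator_of)
  have sc: "singular_chain p (simplex_topology p) ?\<iota>"
    by (simp add: simplicial_imp_singular_chain)
  have bd: "simplicial_chain (p - Suc 0) (standard_simplex p) (chain_boundary p ?\<iota>)"
    using simplicial_chain_boundary[OF simplicial_chain_standard] by simp
  have "chain_boundary (Suc p) (subdivision_homotopy p ?\<iota>)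
      + subdivision_homotopy (p - Suc 0) (chain_boundary p ?\<iota>)
      = singular_subdivision p ?\<iota> - ?\<iota>"
    by (simp add: subdivision_homotopy_simplicial[OF bd]
        subdivision_homotopy_simplicial[OF simplicial_chain_standard]
        singular_subdivision_simplicial_simplex[OF simplicial_chain_standard]
        chain_homotopic_simplicial_subdivision3[OF simplicial_chain_standard])
  then have "chain_map p \<sigma> (chain_boundary (Suc p) (subdivision_homotopy p ?\<iota>)
      + subdivision_homotopy (p - Suc 0) (chain_boundary p ?\<iota>))
      = chain_map p \<sigma> (singular_subdivision p ?\<iota> - ?\<iota>)"
    by simp
  moreover have "chain_map p \<sigma> (chain_boundary (Suc p) (subdivision_homotopy p ?\<iota>))
      = chain_boundary (Suc p) (subdivision_homotopy p (frag_of \<sigma>))"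
    using chain_boundary_chain_map[OF singular_chain_subd_standard, of p \<sigma>]
    by (simp add: subdivision_homotopy_simplicial[OF simplicial_chain_standard] K\<sigma>)
  moreover have "chain_map p \<sigma> (subdivision_homotopy (p - Suc 0) (chain_boundary p ?\<iota>))
      = subdivision_homotopy (p - Suc 0) (chain_boundary p (frag_of \<sigma>))"
  proof (cases p)
    case (Suc k)
    then show ?thesis
      using chain_boundary_chain_map[OF sc, of \<sigma>] \<sigma>
        subdivision_homotopy_chain_map[of k \<sigma> "chain_boundary p ?\<iota>"] by simp
  qed (simp add: chain_boundary_def)
  moreover have "chain_map p \<sigma> (singular_subdivision p ?\<iota>) = singular_subdivision p (frag_of \<sigma>)"
    using naturality_singular_subdivision[OF sc, of \<sigma>] \<sigma> by simp
  ultimately show ?case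
    by (simp only: chain_map_add chain_map_diff \<sigma>)
next
  case (diff a b)
  let ?L = "\<lambda>z. chain_boundary (Suc p) (subdivision_homotopy p z)
       + subdivision_homotopy (p - Suc 0) (chain_boundary p z)"
  have "?L (a - b) = ?L a - ?L b"
    by (simp add: subdivision_homotopy_diff chain_boundary_diff)
  also have "\<dots> = (singular_subdivision p a - a) - (singular_subdivision p b - b)"
    by (simp only: diff)
  finally show ?case
    by (simp add: singular_subdivision_diff)
qed auto

lemma singular_chain_iterated_subdivision:
  "singular_chain p T z \<Longrightarrow> singular_chain p T ((singular_subdivision p ^^ n) z)"
  by (induction n) (auto intro: singular_chain_singular_subdivision)

lemma boundary_iterated_subdivision:
  "singular_chain p T z \<Longrightarrow> chain_boundary p ((singular_subdivision p ^^ n) z)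
    = (singular_subdivision (p - Suc 0) ^^ n) (chain_boundary p z)"
  by (induction n)
     (auto simp: chain_boundary_singular_subdivision[OF singular_chain_iterated_subdivision])

definition iterated_homotopy :: "nat \<Rightarrow> nat \<Rightarrow> 'a chain \<Rightarrow> 'a chain" where
  "iterated_homotopy p n z = (\<Sum>i<n. subdivision_homotopy p ((singular_subdivision p ^^ i) z))"

lemma iterated_homotopy_diff:
  "iterated_homotopy p n (a - b) = iterated_homotopy p n a - iterated_homotopy p n b"
  by (simp add: iterated_homotopy_def singular_subdivision_power_diff subdivision_homotopy_diff
      sum_subtractf)

lemma iterated_homotopy_0 [simp]: "iterated_homotopy p n 0 = 0"
  by (simp add: iterated_homotopy_def)

text \<open>Telescoping: subdivision commutes with the boundary, so the \<open>i\<close>-th summands contribute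
  \<open>S\<^bsup>i+1\<^esup> z - S\<^sup>i z\<close>.\<close>

lemma boundary_iterated_homotopy:
  assumes "singular_chain p T z"
  shows "chain_boundary (Suc p) (iterated_homotopy p n z)
       + iterated_homotopy (p - Suc 0) n (chain_boundary p z)
       = (singular_subdivision p ^^ n) z - z"
proof (induction n)
  case (Suc n)
  let ?S = "(singular_subdivision p ^^ n) z"
  have step: "chain_boundary (Suc p) (subdivision_homotopy p ?S)
       + subdivision_homotopy (p - Suc 0) ((singular_subdivision (p - Suc 0) ^^ n) (chain_boundary p z))
       = singular_subdivision p ?S - ?S"
    using boundary_subdivision_homotopy[OF singular_chain_iterated_subdivision[OF assms], of n]
      boundary_iterated_subdivision[OF assms, of n] by simp
  have "chain_boundary (Suc p) (iterated_homotopy p (Suc n) z)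
       + iterated_homotopy (p - Suc 0) (Suc n) (chain_boundary p z)
     = (chain_boundary (Suc p) (iterated_homotopy p n z)
       + iterated_homotopy (p - Suc 0) n (chain_boundary p z))
     + (chain_boundary (Suc p) (subdivision_homotopy p ?S)
       + subdivision_homotopy (p - Suc 0)
           ((singular_subdivision (p - Suc 0) ^^ n) (chain_boundary p z)))"
    by (simp add: iterated_homotopy_def chain_boundary_add ac_simps)
  also have "\<dots> = ((singular_subdivision p ^^ n) z - z) + (singular_subdivision p ?S - ?S)"
    by (simp only: Suc step)
  finally show ?case
    by simp
qed (simp add: iterated_homotopy_def)

section \<open>Small simplices in a closure space\<close>

lemma closure_simplex_simplex_map:
  assumes \<sigma>: "closure_simplex X c p \<sigma>" and g: "singular_simplex q (simplex_topology p) g"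
  shows "closure_simplex X c q (simplex_map q \<sigma> g)"
proof -
  let ?cl = "\<lambda>k. (closure_of) (simplex_topology k)"
  have \<sigma>': "\<sigma> \<in> standard_simplex p \<rightarrow> X" "\<And>A. A \<subseteq> standard_simplex p \<Longrightarrow> \<sigma> ` ?cl p A \<subseteq> c (\<sigma> ` A)"
    using \<sigma> by (auto simp: closure_simplex_def closure_continuous_def)
  have "closure_continuous (standard_simplex q) (?cl q) (standard_simplex p) (?cl p) g"
    using g closure_continuous_topology[of "simplex_topology q" "simplex_topology p" g]
    by (simp add: singular_simplex_def)
  then have g': "g \<in> standard_simplex q \<rightarrow> standard_simplex p"
      "\<And>A. A \<subseteq> standard_simplex q \<Longrightarrow> g ` ?cl q A \<subseteq> ?cl p (g ` A)"
    by (auto simp: closure_continuous_def)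
  have "simplex_map q \<sigma> g ` ?cl q A \<subseteq> c (simplex_map q \<sigma> g ` A)" if A: "A \<subseteq> standard_simplex q" for A
  proof -
    have img: "simplex_map q \<sigma> g ` B = \<sigma> ` g ` B" if "B \<subseteq> standard_simplex q" for B
      using that by (force simp: simplex_map_def image_iff)
    have "?cl q A \<subseteq> standard_simplex q"
      using closure_of_subset_topspace[of "simplex_topology q" A] by simp
    then have "simplex_map q \<sigma> g ` ?cl q A = \<sigma> ` g ` ?cl q A"
      by (rule img)
    also have "\<dots> \<subseteq> \<sigma> ` ?cl p (g ` A)"
      by (intro image_mono g'(2) A)
    also have "\<dots> \<subseteq> c (\<sigma> ` g ` A)"
      using g'(1) A by (intro \<sigma>'(2)) auto
    finally show ?thesis
      by (simp add: img[OF A])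
  qed
  then show ?thesis
    using \<sigma>'(1) g'(1) by (auto simp: closure_simplex_def closure_continuous_def simplex_map_def)
qed

text \<open>For the one-element family \<open>{X}\<close> these are all simplices of the closure space, so that the
  full and the small complex are instances of one construction.\<close>

definition small_simplices ::
    "'a set \<Rightarrow> ('a set \<Rightarrow> 'a set) \<Rightarrow> 'a set set \<Rightarrow> nat \<Rightarrow> ((nat \<Rightarrow> real) \<Rightarrow> 'a) set" where
  "small_simplices X c \<U> p =
     {\<sigma>. closure_simplex X c p \<sigma> \<and> (\<exists>U\<in>\<U>. \<sigma> ` standard_simplex p \<subseteq> U)}"

lemma small_simplices_whole_space:
  "small_simplices X c {X} p = {\<sigma>. closure_simplex X c p \<sigma>}"
  by (auto simp: small_simplices_def closure_simplex_def closure_continuous_def)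

lemma small_simplices_extensional: "small_simplices X c \<U> p \<subseteq> extensional (standard_simplex p)"
  by (auto simp: small_simplices_def closure_simplex_def)

lemma small_simplex_simplex_map:
  assumes "\<sigma> \<in> small_simplices X c \<U> p" and g: "singular_simplex q (simplex_topology p) g"
  shows "simplex_map q \<sigma> g \<in> small_simplices X c \<U> q"
proof -
  obtain U where "U \<in> \<U>" "\<sigma> ` standard_simplex p \<subseteq> U" and \<sigma>: "closure_simplex X c p \<sigma>"
    using assms by (auto simp: small_simplices_def)
  moreover have "g \<in> standard_simplex q \<rightarrow> standard_simplex p"
    using g by (simp add: singular_simplex_def continuous_map_in_subtopology image_subset_iff_funcset)
  ultimately have "simplex_map q \<sigma> g ` standard_simplex q \<subseteq> U"
    by (auto simp: simplex_map_def)
  then show ?thesis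
    using \<open>U \<in> \<U>\<close> closure_simplex_simplex_map[OF \<sigma> g] by (auto simp: small_simplices_def)
qed

text \<open>Every simplex of the value on \<open>\<sigma>\<close> is \<open>\<sigma>\<close> composed with a continuous map into its domain,
  so it is continuous with image in that of \<open>\<sigma>\<close>.\<close>

lemma small_model_operator:
  assumes z: "Poly_Mapping.keys z \<subseteq> small_simplices X c \<U> p"
    and u: "singular_chain q (simplex_topology p) u"
  shows "Poly_Mapping.keys (model_operator q u z) \<subseteq> small_simplices X c \<U> q"
  unfolding model_operator_def chain_map_def
proof (intro keys_frag_extend_subset)
  fix \<sigma> g assume "\<sigma> \<in> Poly_Mapping.keys z" "g \<in> Poly_Mapping.keys u"
  then show "Poly_Mapping.keys ((frag_of \<circ> simplex_map q \<sigma>) g) \<subseteq> small_simplices X c \<U> q"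
    using z u small_simplex_simplex_map by (fastforce simp: singular_chain_def)
qed

lemma small_singular_subdivision:
  "Poly_Mapping.keys z \<subseteq> small_simplices X c \<U> p
    \<Longrightarrow> Poly_Mapping.keys ((singular_subdivision p ^^ n) z) \<subseteq> small_simplices X c \<U> p"
  by (induction n) (auto simp: singular_subdivision_model
      dest!: small_model_operator[OF _ singular_chain_subdivided_standard])

lemma small_subdivision_homotopy:
  "Poly_Mapping.keys z \<subseteq> small_simplices X c \<U> p
    \<Longrightarrow> Poly_Mapping.keys (subdivision_homotopy p z) \<subseteq> small_simplices X c \<U> (Suc p)"
  unfolding subdivision_homotopy_def
  by (rule small_model_operator[OF _ singular_chain_subd_standard])

lemma small_iterated_homotopy:
  "Poly_Mapping.keys z \<subseteq> small_simplices X c \<U> p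
    \<Longrightarrow> Poly_Mapping.keys (iterated_homotopy p n z) \<subseteq> small_simplices X c \<U> (Suc p)"
  unfolding iterated_homotopy_def
  by (intro keys_sum_subset small_subdivision_homotopy small_singular_subdivision)

text \<open>A face is the composition of the simplex with the corresponding face of the identity.\<close>

lemma small_singular_face:
  assumes "\<sigma> \<in> small_simplices X c \<U> p" "1 \<le> p" "k \<le> p"
  shows "singular_face p k \<sigma> \<in> small_simplices X c \<U> (p - Suc 0)"
proof -
  have "singular_simplex p (simplex_topology p) (restrict id (standard_simplex p))"
    by (simp add: simplicial_imp_singular_simplex)
  then have "singular_simplex (p - Suc 0) (simplex_topology p)
      (singular_face p k (restrict id (standard_simplex p)))"
    using assms by (intro singular_simplex_singular_face) auto
  moreover have "simplex_map (p - Suc 0) \<sigma> (singular_face p k (restrict id (standard_simplex p)))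
      = singular_face p k \<sigma>"
    using assms by (auto simp: simplex_map_def singular_face_def fun_eq_iff
        simplical_face_in_standard_simplex)
  ultimately show ?thesis
    using small_simplex_simplex_map[OF assms(1)] by metis
qed

lemma closure_simplex_singular_face:
  "closure_simplex X c p \<sigma> \<Longrightarrow> 0 < p \<Longrightarrow> k \<le> p
    \<Longrightarrow> closure_simplex X c (p - Suc 0) (singular_face p k \<sigma>)"
  using small_singular_face[of \<sigma> X c "{X}" p k] by (simp add: small_simplices_whole_space)

lemma small_chain_boundary:
  assumes "Poly_Mapping.keys z \<subseteq> small_simplices X c \<U> p"
  shows "Poly_Mapping.keys (chain_boundary p z) \<subseteq> small_simplices X c \<U> (p - Suc 0)"
proof (cases "p = 0")
  case False
  have "Poly_Mapping.keys (frag_cmul ((- 1) ^ k) (frag_of (singular_face p k \<sigma>)))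
      \<subseteq> small_simplices X c \<U> (p - Suc 0)" if "\<sigma> \<in> Poly_Mapping.keys z" "k \<le> p" for \<sigma> k
    using keys_cmul[of "(-1) ^ k" "frag_of (singular_face p k \<sigma>)"] small_singular_face[of \<sigma> X c \<U> p k] that assms False by auto
  then show ?thesis
    using False by (auto simp: chain_boundary_def intro!: keys_frag_extend_subset keys_sum_subset)
qed (simp add: chain_boundary_def)


lemma small_chain_singular_indiscrete:
  "Poly_Mapping.keys z \<subseteq> small_simplices X c \<U> p \<Longrightarrow> singular_chain p indiscrete z"
  using small_simplices_extensional[of X c \<U> p] by (auto simp: singular_chain_indiscrete)

section \<open>Eventual smallness of iterated subdivisions\<close>

lemma (in closure_space) closure_mono: "A \<subseteq> B \<Longrightarrow> B \<subseteq> X \<Longrightarrow> c A \<subseteq> c B"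
  using closure_Un[of A B] by (simp add: Un_absorb1) blast

lemma iterated_subdivision_chain_map:
  assumes "singular_chain p T z"
  shows "(singular_subdivision p ^^ n) (chain_map p g z) = chain_map p g ((singular_subdivision p ^^ n) z)"
  by (induction n)
     (auto simp: naturality_singular_subdivision[OF singular_chain_iterated_subdivision[OF assms]])

text \<open>Continuity of \<open>\<sigma>\<close> gives \<open>\<sigma>(cl(\<Delta> - \<sigma>\<^bsup>-1\<^esup> U)) \<subseteq> c(X - U)\<close>. A point that \<open>\<sigma>\<close> sends to the
  interior of \<open>U\<close> is therefore in the interior of \<open>\<sigma>\<^bsup>-1\<^esup> U\<close>, and these interiors form an open
  cover of the compact simplex. The iterated subdivisions of the identity become fine
  enough for this cover; composing with \<open>\<sigma>\<close> turns them into the subdivisions of \<open>\<sigma>\<close>.\<close>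

lemma eventually_small_subdivision:
  assumes X: "closure_space X c" and cover: "interior_cover X c \<U>" and \<sigma>: "closure_simplex X c p \<sigma>"
  shows "\<exists>n. \<forall>i\<ge>n. Poly_Mapping.keys ((singular_subdivision p ^^ i) (frag_of \<sigma>))
                     \<subseteq> small_simplices X c \<U> p"
proof -
  interpret closure_space X c by fact
  let ?T = "simplex_topology p" and ?\<Delta> = "standard_simplex p"
  define \<V> where "\<V> = (\<lambda>U. ?T interior_of {x \<in> ?\<Delta>. \<sigma> x \<in> U}) ` \<U>"
  have \<sigma>X: "\<sigma> \<in> ?\<Delta> \<rightarrow> X" and \<sigma>c: "\<And>A. A \<subseteq> ?\<Delta> \<Longrightarrow> \<sigma> ` (?T closure_of A) \<subseteq> c (\<sigma> ` A)"
    and ext: "\<sigma> \<in> extensional ?\<Delta>"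
    using \<sigma> by (auto simp: closure_simplex_def closure_continuous_def)
  have "x \<in> \<Union>\<V>" if x: "x \<in> ?\<Delta>" for x
  proof -
    have "\<sigma> x \<in> (\<Union>U\<in>\<U>. closure_interior X c U)"
      using funcset_mem[OF \<sigma>X x] cover by (simp add: interior_cover_def)
    then obtain U where U: "U \<in> \<U>" "\<sigma> x \<notin> c (X - U)"
      by (auto simp: closure_interior_def)
    let ?A = "?\<Delta> - {x \<in> ?\<Delta>. \<sigma> x \<in> U}"
    have "\<sigma> ` (?T closure_of ?A) \<subseteq> c (\<sigma> ` ?A)"
      by (rule \<sigma>c) auto
    also have "\<dots> \<subseteq> c (X - U)"
      using \<sigma>X by (intro closure_mono) auto
    finally have "x \<notin> ?T closure_of ?A"
      using U by auto
    then show ?thesis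
      using x U(1) by (auto simp: \<V>_def interior_of_closure_of)
  qed
  then have \<V>: "topspace ?T \<subseteq> \<Union>\<V>" "\<And>V. V \<in> \<V> \<Longrightarrow> openin ?T V"
    by (auto simp: \<V>_def)
  have std: "singular_chain p ?T (standard_chain p)"
    by (simp add: simplicial_imp_singular_chain)
  obtain n where n: "\<And>i g. n \<le> i \<Longrightarrow> g \<in> Poly_Mapping.keys ((singular_subdivision p ^^ i) (standard_chain p))
      \<Longrightarrow> \<exists>V\<in>\<V>. g \<in> ?\<Delta> \<rightarrow> V"
    using sufficient_iterated_singular_subdivision_exists[OF \<V>(2,1) std] by metis
  have "h \<in> small_simplices X c \<U> p"
    if "n \<le> i" and h: "h \<in> Poly_Mapping.keys ((singular_subdivision p ^^ i) (frag_of \<sigma>))" for i h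
  proof -
    have "chain_map p \<sigma> (standard_chain p) = frag_of \<sigma>"
      using ext singular_simplex_chain_map_id singular_simplex_indiscrete by blast
    then have "(singular_subdivision p ^^ i) (frag_of \<sigma>)
        = chain_map p \<sigma> ((singular_subdivision p ^^ i) (standard_chain p))"
      using iterated_subdivision_chain_map[OF std] by metis
    then obtain g where g: "g \<in> Poly_Mapping.keys ((singular_subdivision p ^^ i) (standard_chain p))"
        and h_eq: "h = simplex_map p \<sigma> g"
      using h keys_frag_extend by (force simp: chain_map_def)
    have "singular_simplex p ?T g"
      using singular_chain_iterated_subdivision[OF std] g by (auto simp: singular_chain_def)
    then have "closure_simplex X c p h"
      unfolding h_eq by (rule closure_simplex_simplex_map[OF \<sigma>])
    moreover obtain U where "U \<in> \<U>" "g \<in> ?\<Delta> \<rightarrow> ?T interior_of {x \<in> ?\<Delta>. \<sigma> x \<in> U}"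
      using n[OF \<open>n \<le> i\<close> g] by (auto simp: \<V>_def)
    moreover from this have "h ` ?\<Delta> \<subseteq> U"
      using interior_of_subset by (fastforce simp: h_eq simplex_map_def)
    ultimately show ?thesis
      by (auto simp: small_simplices_def)
  qed
  then show ?thesis
    by blast
qed

section \<open>Subdividing each simplex as often as it requires\<close>

definition adaptive_homotopy ::
    "(nat \<Rightarrow> ((nat \<Rightarrow> real) \<Rightarrow> 'a) \<Rightarrow> nat) \<Rightarrow> nat \<Rightarrow> 'a chain \<Rightarrow> 'a chain" where
  "adaptive_homotopy m p = frag_extend (\<lambda>\<sigma>. iterated_homotopy p (m p \<sigma>) (frag_of \<sigma>))"

text \<open>The chain map \<open>1 + \<partial>D + D\<partial>\<close> for \<open>D = adaptive_homotopy m\<close>. In degree \<open>0\<close> the boundary is zero,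
  so the truncated index \<open>p - Suc 0\<close> is harmless.\<close>

definition adaptive_subdivision ::
    "(nat \<Rightarrow> ((nat \<Rightarrow> real) \<Rightarrow> 'a) \<Rightarrow> nat) \<Rightarrow> nat \<Rightarrow> 'a chain \<Rightarrow> 'a chain" where
  "adaptive_subdivision m p z = z + (chain_boundary (Suc p) (adaptive_homotopy m p z)
     + adaptive_homotopy m (p - Suc 0) (chain_boundary p z))"

lemma adaptive_homotopy_0 [simp]: "adaptive_homotopy m p 0 = 0"
  by (simp add: adaptive_homotopy_def)

lemma adaptive_homotopy_diff:
  "adaptive_homotopy m p (a - b) = adaptive_homotopy m p a - adaptive_homotopy m p b"
  by (simp add: adaptive_homotopy_def frag_extend_diff)

lemma adaptive_homotopy_add:
  "adaptive_homotopy m p (a + b) = adaptive_homotopy m p a + adaptive_homotopy m p b"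
  by (simp add: adaptive_homotopy_def frag_extend_add)

lemma adaptive_subdivision_0 [simp]: "adaptive_subdivision m p 0 = 0"
  by (simp add: adaptive_subdivision_def)

lemma adaptive_subdivision_add:
  "adaptive_subdivision m p (a + b) = adaptive_subdivision m p a + adaptive_subdivision m p b"
  by (simp add: adaptive_subdivision_def adaptive_homotopy_add chain_boundary_add algebra_simps)

lemma adaptive_subdivision_diff:
  "adaptive_subdivision m p (a - b) = adaptive_subdivision m p a - adaptive_subdivision m p b"
  by (simp add: adaptive_subdivision_def adaptive_homotopy_diff chain_boundary_diff algebra_simps)

lemma small_adaptive_homotopy:
  assumes "Poly_Mapping.keys z \<subseteq> small_simplices X c \<U> p"
  shows "Poly_Mapping.keys (adaptive_homotopy m p z) \<subseteq> small_simplices X c \<U> (Suc p)"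
  unfolding adaptive_homotopy_def
  using assms by (intro keys_frag_extend_subset small_iterated_homotopy) auto

text \<open>Since \<open>\<partial>\<partial> = 0\<close>, both sides are \<open>\<partial>z + \<partial>D\<partial>z\<close>.\<close>

lemma chain_boundary_adaptive_subdivision:
  assumes "Poly_Mapping.keys z \<subseteq> small_simplices X c \<U> p"
  shows "chain_boundary p (adaptive_subdivision m p z)
       = adaptive_subdivision m (p - Suc 0) (chain_boundary p z)"
proof (cases p)
  case (Suc k)
  have "chain_boundary k (chain_boundary p z) = 0"
    using chain_boundary_boundary[OF small_chain_singular_indiscrete[OF assms]] Suc by simp
  moreover have "chain_boundary p (chain_boundary (Suc p) (adaptive_homotopy m p z)) = 0"
    using chain_boundary_boundary[OF small_chain_singular_indiscrete[OF small_adaptive_homotopy[OF assms]]]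
    by simp
  ultimately show ?thesis
    by (simp add: adaptive_subdivision_def chain_boundary_add Suc)
qed (simp add: chain_boundary_def)

text \<open>The common summands cancel; those that remain have indices at least \<open>min a b\<close>.\<close>

lemma small_iterated_homotopy_diff:
  assumes small: "\<And>i. min a b \<le> i \<Longrightarrow>
      Poly_Mapping.keys ((singular_subdivision p ^^ i) z) \<subseteq> small_simplices X c \<U> p"
  shows "Poly_Mapping.keys (iterated_homotopy p a z - iterated_homotopy p b z)
      \<subseteq> small_simplices X c \<U> (Suc p)"
proof -
  have *: "Poly_Mapping.keys (iterated_homotopy p b z - iterated_homotopy p a z)
      \<subseteq> small_simplices X c \<U> (Suc p)"
    if "a \<le> b" and small: "\<And>i. a \<le> i \<Longrightarrow>
      Poly_Mapping.keys ((singular_subdivision p ^^ i) z) \<subseteq> small_simplices X c \<U> p" for a b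
  proof -
    have "{..<b} = {..<a} \<union> {a..<b}"
      using \<open>a \<le> b\<close> by auto
    then have eq: "iterated_homotopy p b z - iterated_homotopy p a z
        = (\<Sum>i=a..<b. subdivision_homotopy p ((singular_subdivision p ^^ i) z))"
      unfolding iterated_homotopy_def by (simp add: sum.union_disjoint ivl_disj_int)
    show ?thesis
      unfolding eq by (intro keys_sum_subset small_subdivision_homotopy small) simp
  qed
  show ?thesis
  proof (cases "a \<le> b")
    case True
    then have "Poly_Mapping.keys (iterated_homotopy p b z - iterated_homotopy p a z)
      \<subseteq> small_simplices X c \<U> (Suc p)"
      using small by (intro *) auto
    then show ?thesis
      using keys_minus[of "iterated_homotopy p a z - iterated_homotopy p b z"] by simp
  next
    case False
    then show ?thesis
      using small by (intro *) auto
  qed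
qed

lemma keys_chain_boundary_frag_of:
  assumes "0 < p"
  shows "Poly_Mapping.keys (chain_boundary p (frag_of \<sigma>)) \<subseteq> (\<lambda>k. singular_face p k \<sigma>) ` {..p}"
proof -
  have "Poly_Mapping.keys (frag_cmul ((- 1) ^ k) (frag_of (singular_face p k \<sigma>)))
      \<subseteq> (\<lambda>k. singular_face p k \<sigma>) ` {..p}" if "k \<le> p" for k
    using keys_cmul[of "(-1) ^ k" "frag_of (singular_face p k \<sigma>)"] that by auto
  then show ?thesis
    using assms by (auto simp: chain_boundary_of intro!: keys_sum_subset)
qed

text \<open>The identity \<open>\<rho>(\<sigma>) = S\<^sup>m \<sigma> + (D - D\<^sub>m)(\<partial>\<sigma>)\<close> with \<open>m = m(\<sigma>)\<close> reduces the claim to the faces of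
  \<open>\<sigma>\<close>. Asking \<open>m(\<sigma>)\<close> to be large enough for the faces too makes it irrelevant whether \<open>m(\<tau>)\<close>
  is at most \<open>m(\<sigma>)\<close> for a face \<open>\<tau>\<close>.\<close>

lemma small_adaptive_subdivision:
  assumes z: "Poly_Mapping.keys z \<subseteq> {\<sigma>. closure_simplex X c p \<sigma>}"
    and m: "\<And>p \<sigma> i. closure_simplex X c p \<sigma> \<Longrightarrow> m p \<sigma> \<le> i \<Longrightarrow>
       Poly_Mapping.keys ((singular_subdivision p ^^ i) (frag_of \<sigma>)) \<subseteq> small_simplices X c \<U> p"
    and m_face: "\<And>p \<sigma> k i. closure_simplex X c p \<sigma> \<Longrightarrow> 0 < p \<Longrightarrow> k \<le> p \<Longrightarrow> m p \<sigma> \<le> i \<Longrightarrow>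
       Poly_Mapping.keys ((singular_subdivision (p - Suc 0) ^^ i) (frag_of (singular_face p k \<sigma>)))
         \<subseteq> small_simplices X c \<U> (p - Suc 0)"
  shows "Poly_Mapping.keys (adaptive_subdivision m p z) \<subseteq> small_simplices X c \<U> p"
  using z
proof (induction z rule: frag_induction)
  case (one \<sigma>)
  then have \<sigma>: "closure_simplex X c p \<sigma>"
    by simp
  \<comment> \<open>The discrepancy \<open>D - D\<^sub>m\<close>, which is additive and therefore controlled by its values on faces.\<close>
  define E where "E w = adaptive_homotopy m (p - Suc 0) w - iterated_homotopy (p - Suc 0) (m p \<sigma>) w" for w
  have "singular_chain p indiscrete (frag_of \<sigma>)"
    using \<sigma> by (simp add: singular_chain_indiscrete closure_simplex_def)
  then have "adaptive_subdivision m p (frag_of \<sigma>)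
      = (singular_subdivision p ^^ m p \<sigma>) (frag_of \<sigma>) + E (chain_boundary p (frag_of \<sigma>))"
    using boundary_iterated_homotopy[of p indiscrete "frag_of \<sigma>" "m p \<sigma>"]
    by (simp add: adaptive_subdivision_def E_def adaptive_homotopy_def algebra_simps)
  moreover have "Poly_Mapping.keys (E (chain_boundary p (frag_of \<sigma>))) \<subseteq> small_simplices X c \<U> p"
  proof (cases "p = 0")
    case False
    have "Poly_Mapping.keys (E w) \<subseteq> small_simplices X c \<U> p"
      if "Poly_Mapping.keys w \<subseteq> (\<lambda>k. singular_face p k \<sigma>) ` {..p}" for w
      using that
    proof (induction w rule: frag_induction)
      case (one \<tau>)
      then obtain k where k: "k \<le> p" "\<tau> = singular_face p k \<sigma>"
        by auto
      have "Poly_Mapping.keys ((singular_subdivision (p - Suc 0) ^^ i) (frag_of \<tau>))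
          \<subseteq> small_simplices X c \<U> (p - Suc 0)" if "min (m (p - Suc 0) \<tau>) (m p \<sigma>) \<le> i" for i
        using that m[OF closure_simplex_singular_face[OF \<sigma>], of k i] m_face[OF \<sigma>, of k i] False k
        by (auto simp: min_le_iff_disj)
      then show ?case
        using small_iterated_homotopy_diff[of "m (p - Suc 0) \<tau>" "m p \<sigma>" "p - Suc 0" "frag_of \<tau>" X c \<U>] False
        by (simp add: E_def adaptive_homotopy_def)
    next
      case (diff a b)
      have "E (a - b) = E a - E b"
        by (simp add: E_def adaptive_homotopy_diff iterated_homotopy_diff)
      then show ?case
        using diff by (simp add: keys_diff_subset)
    qed (simp add: E_def)
    then show ?thesis
      using keys_chain_boundary_frag_of False by blast
  qed (simp add: E_def chain_boundary_def)
  ultimately show ?case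
    using m[OF \<sigma> order_refl] by (simp add: keys_add_subset)
next
  case (diff a b)
  then show ?case
    by (simp add: adaptive_subdivision_diff keys_diff_subset)
qed auto

section \<open>The inclusion of small chains\<close>

lemma small_chain_group_eq:
  "small_chain_group X c \<U> n = free_Abelian_group {\<sigma>. 0 \<le> n \<and> \<sigma> \<in> small_simplices X c \<U> (nat n)}"
  unfolding small_chain_group_def closure_chain_group_def free_Abelian_group_def
  by (auto simp: small_simplices_def)

lemma singular_complex_eq_small_complex: "singular_complex X c = small_complex X c {X}"
proof -
  have "closure_chain_group X c = small_chain_group X c {X}"
    by (rule ext) (simp add: small_chain_group_eq closure_chain_group_def small_simplices_whole_space)
  then show ?thesis
    by (simp add: singular_complex_def small_complex_def)
qed

lemma carrier_small_chain_group:
  "z \<in> carrier (small_chain_group X c \<U> n)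
     \<longleftrightarrow> Poly_Mapping.keys z \<subseteq> small_simplices X c \<U> (nat n) \<and> (n < 0 \<longrightarrow> z = 0)"
  by (auto simp: small_chain_group_eq)

lemma small_chain_group_simps:
  "x \<otimes>\<^bsub>small_chain_group X c \<U> n\<^esub> y = x + y" "\<one>\<^bsub>small_chain_group X c \<U> n\<^esub> = 0"
  by (simp_all add: small_chain_group_eq)

lemma inv_small_chain_group:
  "z \<in> carrier (small_chain_group X c \<U> n) \<Longrightarrow> inv\<^bsub>small_chain_group X c \<U> n\<^esub> z = - z"
  by (simp add: small_chain_group_eq)

lemma small_complex_simps [simp]:
  "grp (small_complex X c \<U>) = small_chain_group X c \<U>"
  "bdry (small_complex X c \<U>) n = chain_boundary (nat n)"
  by (simp_all add: small_complex_def)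

lemma nat_minus_one: "nat (n - 1) = nat n - Suc 0"
  by simp

lemma chain_complex_small_complex: "chain_complex (small_complex X c \<U>)"
  unfolding chain_complex_def
proof (intro conjI allI ballI)
  fix n :: int
  show "comm_group (grp (small_complex X c \<U>) n)"
    by (simp add: small_chain_group_eq abelian_free_Abelian_group)
  show "bdry (small_complex X c \<U>) n \<in> hom (grp (small_complex X c \<U>) n) (grp (small_complex X c \<U>) (n - 1))"
  proof (rule homI)
    fix z assume "z \<in> carrier (grp (small_complex X c \<U>) n)"
    then show "bdry (small_complex X c \<U>) n z \<in> carrier (grp (small_complex X c \<U>) (n - 1))"
      using small_chain_boundary[of z X c \<U> "nat n"]
      by (auto simp: carrier_small_chain_group nat_minus_one chain_boundary_def)
  qed (simp add: small_chain_group_simps chain_boundary_add)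
  fix z assume "z \<in> carrier (grp (small_complex X c \<U>) n)"
  then show "bdry (small_complex X c \<U>) (n - 1) (bdry (small_complex X c \<U>) n z)
      = \<one>\<^bsub>grp (small_complex X c \<U>) (n - 2)\<^esub>"
    using chain_boundary_boundary[OF small_chain_singular_indiscrete[of z X c \<U> "nat n"]]
    by (simp add: carrier_small_chain_group nat_minus_one small_chain_group_simps)
qed

text \<open>This is used for the given cover as well as for \<open>{X}\<close>: the same homotopy serves both composites
  of the inclusion with its homotopy inverse.\<close>

lemma adaptive_subdivision_homotopic_id:
  "chain_homotopic (small_complex X c \<U>) (small_complex X c \<U>)
     (\<lambda>n. adaptive_subdivision m (nat n)) (\<lambda>n z. z)"
  unfolding chain_homotopic_def
proof (intro exI[of _ "\<lambda>n. adaptive_homotopy m (nat n)"] conjI allI ballI)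
  fix n :: int
  show "adaptive_homotopy m (nat n)
      \<in> hom (grp (small_complex X c \<U>) n) (grp (small_complex X c \<U>) (n + 1))"
  proof (rule homI)
    fix z assume "z \<in> carrier (grp (small_complex X c \<U>) n)"
    then show "adaptive_homotopy m (nat n) z \<in> carrier (grp (small_complex X c \<U>) (n + 1))"
      using small_adaptive_homotopy[of z X c \<U> "nat n" m]
      by (cases "0 \<le> n") (auto simp: carrier_small_chain_group nat_add_distrib)
  qed (simp add: small_chain_group_simps adaptive_homotopy_add)
  fix z assume z: "z \<in> carrier (grp (small_complex X c \<U>) n)"
  show "adaptive_subdivision m (nat n) z \<otimes>\<^bsub>grp (small_complex X c \<U>) n\<^esub> inv\<^bsub>grp (small_complex X c \<U>) n\<^esub> z
     = bdry (small_complex X c \<U>) (n + 1) (adaptive_homotopy m (nat n) z)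
       \<otimes>\<^bsub>grp (small_complex X c \<U>) n\<^esub> adaptive_homotopy m (nat (n - 1)) (bdry (small_complex X c \<U>) n z)"
  proof (cases "0 \<le> n")
    case True
    then show ?thesis
      using z by (simp add: inv_small_chain_group small_chain_group_simps adaptive_subdivision_def
          nat_add_distrib nat_minus_one)
  next
    case False
    then show ?thesis
      using z by (simp add: inv_small_chain_group small_chain_group_simps carrier_small_chain_group)
  qed
qed

text \<open>If \<open>N(\<sigma>)\<close> or more subdivisions suffice for \<open>\<sigma>\<close>, the sum of \<open>N(\<sigma>)\<close> and of the numbers for its faces
  suffices for \<open>\<sigma>\<close> and its faces simultaneously.\<close>

lemma exists_adaptive_subdivision:
  fixes X :: "'a set"
  assumes "closure_space X c" "interior_cover X c \<U>"
  obtains m where "\<And>p z. Poly_Mapping.keys z \<subseteq> {\<sigma>. closure_simplex X c p \<sigma>} \<Longrightarrow>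
     Poly_Mapping.keys (adaptive_subdivision m p z) \<subseteq> small_simplices X c \<U> p"
proof -
  have "\<forall>p \<sigma>. \<exists>n. closure_simplex X c p \<sigma> \<longrightarrow> (\<forall>i\<ge>n.
      Poly_Mapping.keys ((singular_subdivision p ^^ i) (frag_of \<sigma>)) \<subseteq> small_simplices X c \<U> p)"
    using eventually_small_subdivision[OF assms] by blast
  then obtain N where N: "\<And>p \<sigma> i. closure_simplex X c p \<sigma> \<Longrightarrow> N p \<sigma> \<le> i \<Longrightarrow>
      Poly_Mapping.keys ((singular_subdivision p ^^ i) (frag_of \<sigma>)) \<subseteq> small_simplices X c \<U> p"
    by metis
  define m where "m p \<sigma> = N p \<sigma> + (\<Sum>k\<le>p. N (p - Suc 0) (singular_face p k \<sigma>))" for p \<sigma>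
  have m_face: "N (p - Suc 0) (singular_face p k \<sigma>) \<le> m p \<sigma>" if "k \<le> p" for p k \<sigma>
    using member_le_sum[of k "{..p}" "\<lambda>k. N (p - Suc 0) (singular_face p k \<sigma>)"] that
    by (simp add: m_def)
  have m: "N p \<sigma> \<le> m p \<sigma>" for p \<sigma>
    by (simp add: m_def)
  show ?thesis
  proof (rule that[of m])
    fix p and z :: "'a chain" assume z: "Poly_Mapping.keys z \<subseteq> {\<sigma>. closure_simplex X c p \<sigma>}"
    show "Poly_Mapping.keys (adaptive_subdivision m p z) \<subseteq> small_simplices X c \<U> p"
    proof (rule small_adaptive_subdivision[OF z])
      show "Poly_Mapping.keys ((singular_subdivision p ^^ i) (frag_of \<sigma>)) \<subseteq> small_simplices X c \<U> p"
        if "closure_simplex X c p \<sigma>" "m p \<sigma> \<le> i" for p \<sigma> i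
        using N that m[of p \<sigma>] by (meson order_trans)
      show "Poly_Mapping.keys ((singular_subdivision (p - Suc 0) ^^ i) (frag_of (singular_face p k \<sigma>)))
          \<subseteq> small_simplices X c \<U> (p - Suc 0)"
        if "closure_simplex X c p \<sigma>" "0 < p" "k \<le> p" "m p \<sigma> \<le> i" for p \<sigma> k i
        using N[OF closure_simplex_singular_face[OF that(1-3)]] order_trans[OF m_face[OF that(3)] that(4)]
        by blast
    qed
  qed
qed

lemma chain_homotopy_equivalence_small_complex:
  assumes "closure_space X c" and cover: "interior_cover X c \<U>"
  shows "chain_homotopy_equivalence (small_complex X c \<U>) (singular_complex X c) (\<lambda>n z. z)"
proof -
  obtain m where m: "\<And>p z. Poly_Mapping.keys z \<subseteq> small_simplices X c {X} p \<Longrightarrow>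
     Poly_Mapping.keys (adaptive_subdivision m p z) \<subseteq> small_simplices X c \<U> p"
    using exists_adaptive_subdivision[OF assms] by (metis small_simplices_whole_space)
  let ?\<rho> = "\<lambda>n. adaptive_subdivision m (nat n)"
  have "small_simplices X c \<U> p \<subseteq> small_simplices X c {X} p" for p
    by (auto simp: small_simplices_whole_space) (simp add: small_simplices_def)
  then have "z \<in> carrier (small_chain_group X c {X} n)"
    if "z \<in> carrier (small_chain_group X c \<U> n)" for n z
    using that unfolding carrier_small_chain_group by (meson subset_trans)
  then have incl: "complex_map (small_complex X c \<U>) (small_complex X c {X}) (\<lambda>n z. z)"
    by (auto simp: complex_map_def hom_def small_chain_group_simps)
  have "complex_map (small_complex X c {X}) (small_complex X c \<U>) ?\<rho>"
    unfolding complex_map_def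
  proof (intro conjI allI ballI)
    fix n :: int
    show "?\<rho> n \<in> hom (grp (small_complex X c {X}) n) (grp (small_complex X c \<U>) n)"
      using m by (auto simp: hom_def carrier_small_chain_group small_chain_group_simps
          adaptive_subdivision_add)
    fix z assume "z \<in> carrier (grp (small_complex X c {X}) n)"
    then show "bdry (small_complex X c \<U>) n (?\<rho> n z) = ?\<rho> (n - 1) (bdry (small_complex X c {X}) n z)"
      using chain_boundary_adaptive_subdivision[of z X c "{X}" "nat n" m]
      by (simp add: carrier_small_chain_group nat_minus_one)
  qed
  moreover have "chain_homotopic (small_complex X c \<V>) (small_complex X c \<V>)
      (\<lambda>n. ?\<rho> n \<circ> (\<lambda>z. z)) (\<lambda>n z. z)"
    "chain_homotopic (small_complex X c \<V>) (small_complex X c \<V>)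
      (\<lambda>n. (\<lambda>z. z) \<circ> ?\<rho> n) (\<lambda>n z. z)" for \<V>
    using adaptive_subdivision_homotopic_id[of X c \<V> m] by (simp_all add: o_def)
  ultimately show ?thesis
    unfolding chain_homotopy_equivalence_def singular_complex_eq_small_complex
    by (intro conjI exI[of _ ?\<rho>] incl chain_complex_small_complex) auto
qed

theorem proposition4p5:
  fixes X :: "'a set" and c :: "'a set \<Rightarrow> 'a set" and \<U> :: "'a set set"
  assumes "closure_space X c"
    and "interior_cover X c \<U>"
  shows "chain_homotopy_equivalence (small_complex X c \<U>) (singular_complex X c) (\<lambda>n z. z) \<and>
         (\<forall>n::int. homology_map (small_complex X c \<U>) (singular_complex X c) (\<lambda>n z. z) n
            \<in> iso (complex_homology (small_complex X c \<U>) n)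
                  (complex_homology (singular_complex X c) n))"
  using chain_homotopy_equivalence_small_complex[OF assms]
    chain_homotopy_equivalence_imp_homology_iso by blast

end
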